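(* For a topological space $(X,\tau)$ the following conditions are equivalent: (a) $(X,\tau)$ is p-closed; (b) every maximal filter base on $X$ pre-$\theta$-converges to some point of $X$; (c) every filter base on $X$ pre-$\theta$-accumulates at some point of $X$; (d) for every family $\{V_\alpha : \alpha\in A\}$ of preclosed subsets of $X$ such that $\bigcap\{V_\alpha : \alpha\in A\}=\emptyset$, there exists a finite subset $A_0$ of $A$ such that $\bigcap\{\mathrm{pint}(V_\alpha) : \alpha\in A_0\}=\emptyset$.
   Context: A subset $A$ of a space $(X,\tau)$ is preopen if $A \subseteq \mathrm{int}(\mathrm{cl}(A))$; it is preclosed if its complement is preopen, i.e. $\mathrm{cl}(\mathrm{int}(A)) \subseteq A$. The preclosure $\mathrm{pcl}(A)$ is the intersection of all preclosed supersets of $A$; the preinterior $\mathrm{pint}(A)$ is the union of all preopen subsets of $A$. $PO(X,x)$ denotes the family of preopen subsets of $X$ containing the point $x$. $(X,\tau)$ is p-closed if for every cover $\{V_\alpha : \alpha\in A\}$ of $X$ by preopen sets there is a finite $A_0\subseteq A$ with $X=\bigcup_{\alpha\in A_0}\mathrm{pcl}(V_\alpha)$. A filter base on $X$ is a nonempty family of nonempty subsets of $X$ such that the intersection of any two members contains a member; a maximal filter base is one that is maximal with respect to inclusion among filter bases on $X$. A filter base $\mathcal{F}$ pre-$\theta$-converges to $x\in X$ if for each $V\in PO(X,x)$ there exists $F\in\mathcal{F}$ with $F\subseteq\mathrm{pcl}(V)$. A filter base $\mathcal{F}$ pre-$\theta$-accumulates at $x\in X$ if $\mathrm{pcl}(V)\cap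 F\neq\emptyset$ for every $V\in PO(X,x)$ and every $F\in\mathcal{F}$. An intersection over an empty index set is understood to be $X$. *)

theory Defs
  imports "HOL-Analysis.Analysis"
begin

definition preopenin :: "'a topology \<Rightarrow> 'a set \<Rightarrow> bool" where
  "preopenin X A \<longleftrightarrow> A \<subseteq> topspace X \<and> A \<subseteq> X interior_of (X closure_of A)"

definition preclosedin :: "'a topology \<Rightarrow> 'a set \<Rightarrow> bool" where
  "preclosedin X A \<longleftrightarrow> A \<subseteq> topspace X \<and> preopenin X (topspace X - A)"

lemma preclosedin_iff:
  "preclosedin X A \<longleftrightarrow> A \<subseteq> topspace X \<and> X closure_of (X interior_of A) \<subseteq> A"
proof (cases "A \<subseteq> topspace X")
  case True
  have "X interior_of (X closure_of (topspace X - A)) = topspace X - X closure_of (X interior_of A)"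
    by (simp add: closure_of_complement interior_of_complement)
  then show ?thesis
    using True closure_of_subset_topspace[of X "X interior_of A"]
    unfolding preclosedin_def preopenin_def by auto
qed (simp add: preclosedin_def)

(* Only meant for A contained in topspace X: then topspace X is itself a preclosed
   superset of A, so the intersection is never over an empty family. *)
definition preclosure_of :: "'a topology \<Rightarrow> 'a set \<Rightarrow> 'a set" (infixr \<open>preclosure'_of\<close> 80) where
  "X preclosure_of A = \<Inter>{C. preclosedin X C \<and> A \<subseteq> C}"

definition preinterior_of :: "'a topology \<Rightarrow> 'a set \<Rightarrow> 'a set" (infixr \<open>preinterior'_of\<close> 80) where
  "X preinterior_of A = \<Union>{U. preopenin X U \<and> U \<subseteq> A}"

(* Covers are sets of sets, as in compactin, rather than indexed families; a finite
   subfamily of an indexed family is the same as a finite subset of its range here. *)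
definition p_closed_space :: "'a topology \<Rightarrow> bool" where
  "p_closed_space X \<longleftrightarrow>
     (\<forall>\<V>. (\<forall>V\<in>\<V>. preopenin X V) \<and> \<Union>\<V> = topspace X \<longrightarrow>
          (\<exists>\<V>\<^sub>0. finite \<V>\<^sub>0 \<and> \<V>\<^sub>0 \<subseteq> \<V> \<and> topspace X = (\<Union>V\<in>\<V>\<^sub>0. X preclosure_of V)))"

definition filter_base_on :: "'a set \<Rightarrow> 'a set set \<Rightarrow> bool" where
  "filter_base_on S \<F> \<longleftrightarrow>
     \<F> \<noteq> {} \<and> (\<forall>F\<in>\<F>. F \<noteq> {} \<and> F \<subseteq> S) \<and> (\<forall>F\<in>\<F>. \<forall>G\<in>\<F>. \<exists>H\<in>\<F>. H \<subseteq> F \<inter> G)"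

definition maximal_filter_base_on :: "'a set \<Rightarrow> 'a set set \<Rightarrow> bool" where
  "maximal_filter_base_on S \<F> \<longleftrightarrow>
     filter_base_on S \<F> \<and> (\<forall>\<G>. filter_base_on S \<G> \<and> \<F> \<subseteq> \<G> \<longrightarrow> \<G> = \<F>)"

definition pre_theta_converges :: "'a topology \<Rightarrow> 'a set set \<Rightarrow> 'a \<Rightarrow> bool" where
  "pre_theta_converges X \<F> x \<longleftrightarrow>
     (\<forall>V. preopenin X V \<and> x \<in> V \<longrightarrow> (\<exists>F\<in>\<F>. F \<subseteq> X preclosure_of V))"

definition pre_theta_accumulates :: "'a topology \<Rightarrow> 'a set set \<Rightarrow> 'a \<Rightarrow> bool" where
  "pre_theta_accumulates X \<F> x \<longleftrightarrow>
     (\<forall>V. preopenin X V \<and> x \<in> V \<longrightarrow> (\<forall>F\<in>\<F>. X preclosure_of V \<inter> F \<noteq> {}))"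

end

theory Submission
  imports Defs
begin

text \<open>
  Three mechanisms give the equivalences.

  Compactness and filter bases: from a cover by preopen sets none of whose finite subfamilies has
  preclosures covering the space one gets a filter base without a pre-theta-accumulation
  point, and conversely. Given the base, the preopen sets whose preclosure misses some member form the
  cover; a finite subcover would force finitely many members to have empty common
  intersection. Given the cover, the complements of finite unions of preclosures form the
  base; it cannot accumulate at \<open>x\<close>, because \<open>x\<close> lies in some member \<open>V\<close> of the cover and
  the complement of the preclosure of \<open>V\<close> belongs to the base.

  Maximality: for a maximal filter base, accumulation and convergence at a point coincide,
  since a set that meets all members contains a member (its traces on the members can be
  adjoined without leaving the filter bases). By Zorn's lemma every filter base lies in a
  maximal one, and accumulation is inherited by smaller families.

  Duality: complementation exchanges preopen with preclosed sets and preclosure with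
  preinterior, which turns covers into families with empty intersection.
\<close>

section \<open>Filter bases\<close>

lemma filter_base_onI:
  assumes "\<F> \<noteq> {}"
    and "\<And>F. F \<in> \<F> \<Longrightarrow> F \<noteq> {} \<and> F \<subseteq> S"
    and "\<And>F G. F \<in> \<F> \<Longrightarrow> G \<in> \<F> \<Longrightarrow> \<exists>H\<in>\<F>. H \<subseteq> F \<inter> G"
  shows "filter_base_on S \<F>"
  using assms by (simp add: filter_base_on_def)

lemma filter_base_on_member:
  "filter_base_on S \<F> \<Longrightarrow> F \<in> \<F> \<Longrightarrow> F \<noteq> {} \<and> F \<subseteq> S"
  by (simp add: filter_base_on_def)

lemma filter_base_on_nonempty: "filter_base_on S \<F> \<Longrightarrow> \<F> \<noteq> {}"
  by (simp add: filter_base_on_def)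

lemma filter_base_on_meet:
  assumes "filter_base_on S \<F>" "F \<in> \<F>" "G \<in> \<F>"
  obtains H where "H \<in> \<F>" "H \<subseteq> F \<inter> G"
  using assms unfolding filter_base_on_def by meson

lemma filter_base_on_finite_Inter:
  assumes "filter_base_on S \<F>" "finite \<G>" "\<G> \<subseteq> \<F>"
  shows "\<exists>H\<in>\<F>. H \<subseteq> \<Inter>\<G>"
  using assms(2,3)
proof (induction \<G>)
  case empty
  then show ?case
    using filter_base_on_nonempty[OF assms(1)] by auto
next
  case (insert G \<G>)
  then obtain H where "H \<in> \<F>" "H \<subseteq> \<Inter>\<G>"
    by auto
  moreover obtain K where "K \<in> \<F>" "K \<subseteq> G \<inter> H"
    using filter_base_on_meet[OF assms(1) _ \<open>H \<in> \<F>\<close>] insert.prems by blast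
  ultimately show ?case
    by blast
qed

text \<open>
  Two members of the union of a chain already lie in one member of the chain, so the
  union of a chain of filter bases is a filter base and Zorn's lemma applies.
\<close>
lemma filter_base_on_extends_to_maximal:
  assumes "filter_base_on S \<F>"
  obtains \<M> where "maximal_filter_base_on S \<M>" "\<F> \<subseteq> \<M>"
proof -
  let ?A = "{\<G>. filter_base_on S \<G> \<and> \<F> \<subseteq> \<G>}"
  have "\<exists>\<M>\<in>?A. \<forall>\<G>\<in>?A. \<M> \<subseteq> \<G> \<longrightarrow> \<G> = \<M>"
  proof (rule subset_Zorn_nonempty)
    show "?A \<noteq> {}"
      using assms by blast
    fix C assume ne: "C \<noteq> {}" and chain: "subset.chain ?A C"
    have mem: "\<And>\<G>. \<G> \<in> C \<Longrightarrow> filter_base_on S \<G>" "\<And>\<G>. \<G> \<in> C \<Longrightarrow> \<F> \<subseteq> \<G>"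
      using chain by (auto simp: subset_chain_def)
    have meet: "\<exists>H\<in>\<Union>C. H \<subseteq> F \<inter> G" if FG: "F \<in> \<Union>C" "G \<in> \<Union>C" for F G
    proof -
      obtain \<A> \<B> where "\<A> \<in> C" "F \<in> \<A>" "\<B> \<in> C" "G \<in> \<B>"
        using FG by blast
      moreover then have "\<A> \<subseteq> \<B> \<or> \<B> \<subseteq> \<A>"
        using chain by (simp add: subset_chain_def)
      ultimately obtain \<G> where "\<G> \<in> C" "F \<in> \<G>" "G \<in> \<G>"
        by blast
      moreover then obtain H where "H \<in> \<G>" "H \<subseteq> F \<inter> G"
        using filter_base_on_meet mem(1) by metis
      ultimately show ?thesis
        by blast
    qed
    have "\<F> \<subseteq> \<Union>C"
      using ne mem(2) by blast
    moreover have "filter_base_on S (\<Union>C)"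
    proof (intro filter_base_onI meet)
      show "\<Union>C \<noteq> {}"
        using \<open>\<F> \<subseteq> \<Union>C\<close> filter_base_on_nonempty[OF assms] by blast
      show "F \<noteq> {} \<and> F \<subseteq> S" if "F \<in> \<Union>C" for F
        using that filter_base_on_member[OF mem(1)] by blast
    qed
    ultimately show "\<Union>C \<in> ?A"
      by simp
  qed
  then obtain \<M> where "filter_base_on S \<M>" "\<F> \<subseteq> \<M>"
    and "\<And>\<G>. filter_base_on S \<G> \<Longrightarrow> \<F> \<subseteq> \<G> \<Longrightarrow> \<M> \<subseteq> \<G> \<Longrightarrow> \<G> = \<M>"
    by auto
  then have "maximal_filter_base_on S \<M>"
    by (auto simp: maximal_filter_base_on_def)
  with \<open>\<F> \<subseteq> \<M>\<close> show ?thesis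
    using that by blast
qed

text \<open>
  The members together with their traces on \<open>A\<close> form a filter base, which by maximality
  is nothing new; so the traces on \<open>A\<close> are themselves members.
\<close>
lemma maximal_filter_base_on_contains_subset:
  assumes max: "maximal_filter_base_on S \<M>"
    and meets: "\<And>F. F \<in> \<M> \<Longrightarrow> A \<inter> F \<noteq> {}"
  shows "\<exists>F\<in>\<M>. F \<subseteq> A"
proof -
  let ?T = "(\<lambda>F. A \<inter> F) ` \<M>"
  have base: "filter_base_on S \<M>"
    using max by (simp add: maximal_filter_base_on_def)
  have meet: "\<exists>H\<in>\<M> \<union> ?T. H \<subseteq> F \<inter> G" if FG: "F \<in> \<M> \<union> ?T" "G \<in> \<M> \<union> ?T" for F G
  proof -
    obtain F' G' where "F' \<in> \<M>" "A \<inter> F' \<subseteq> F" "G' \<in> \<M>" "A \<inter> G' \<subseteq> G"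
      using FG by blast
    moreover then obtain H where "H \<in> \<M>" "H \<subseteq> F' \<inter> G'"
      using filter_base_on_meet[OF base] by metis
    ultimately show ?thesis
      by (intro bexI[of _ "A \<inter> H"]) auto
  qed
  have "\<M> \<noteq> {}"
    by (rule filter_base_on_nonempty[OF base])
  have "filter_base_on S (\<M> \<union> ?T)"
  proof (intro filter_base_onI meet)
    show "\<M> \<union> ?T \<noteq> {}"
      using \<open>\<M> \<noteq> {}\<close> by simp
    show "F \<noteq> {} \<and> F \<subseteq> S" if "F \<in> \<M> \<union> ?T" for F
      using that filter_base_on_member[OF base] meets by auto
  qed
  then have "\<M> \<union> ?T = \<M>"
    using max by (simp add: maximal_filter_base_on_def)
  with \<open>\<M> \<noteq> {}\<close> show ?thesis
    by blast
qed

section \<open>Preclosure and preinterior\<close>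

lemma preclosedin_topspace: "preclosedin X (topspace X)"
  by (simp add: preclosedin_def preopenin_def)

lemma preclosure_of_subset_topspace:
  "A \<subseteq> topspace X \<Longrightarrow> X preclosure_of A \<subseteq> topspace X"
  unfolding preclosure_of_def using preclosedin_topspace by blast

lemma preopenin_subset_topspace: "preopenin X A \<Longrightarrow> A \<subseteq> topspace X"
  by (simp add: preopenin_def)

lemma preclosedin_subset_topspace: "preclosedin X A \<Longrightarrow> A \<subseteq> topspace X"
  by (simp add: preclosedin_def)

lemma preclosedin_complement:
  "A \<subseteq> topspace X \<Longrightarrow> preclosedin X (topspace X - A) \<longleftrightarrow> preopenin X A"
  by (simp add: preclosedin_def double_diff)

lemma preinterior_of_complement:
  assumes "A \<subseteq> topspace X"
  shows "X preinterior_of (topspace X - A) = topspace X - X preclosure_of A"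
proof (intro equalityI subsetI)
  fix x assume "x \<in> X preinterior_of (topspace X - A)"
  then obtain U where U: "preopenin X U" "U \<subseteq> topspace X - A" "x \<in> U"
    by (auto simp: preinterior_of_def)
  then have "preclosedin X (topspace X - U)"
    using preclosedin_complement preopenin_subset_topspace by metis
  moreover have "A \<subseteq> topspace X - U"
    using U assms by blast
  ultimately have "X preclosure_of A \<subseteq> topspace X - U"
    by (auto simp: preclosure_of_def)
  then show "x \<in> topspace X - X preclosure_of A"
    using U by blast
next
  fix x assume "x \<in> topspace X - X preclosure_of A"
  then obtain C where "preclosedin X C" "A \<subseteq> C" "x \<in> topspace X - C"
    by (auto simp: preclosure_of_def)
  then have "preopenin X (topspace X - C)" "topspace X - C \<subseteq> topspace X - A"
    by (auto simp: preclosedin_def)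
  with \<open>x \<in> topspace X - C\<close> show "x \<in> X preinterior_of (topspace X - A)"
    by (auto simp: preinterior_of_def)
qed

lemma preclosure_of_complement:
  assumes "A \<subseteq> topspace X"
  shows "X preclosure_of (topspace X - A) = topspace X - X preinterior_of A"
proof -
  have "X preinterior_of A = topspace X - X preclosure_of (topspace X - A)"
    using preinterior_of_complement[of "topspace X - A" X] assms by (simp add: double_diff)
  then show ?thesis
    using preclosure_of_subset_topspace[of "topspace X - A" X] by blast
qed

section \<open>Accumulation and convergence\<close>

lemma pre_theta_accumulates_antimono:
  "pre_theta_accumulates X \<G> x \<Longrightarrow> \<F> \<subseteq> \<G> \<Longrightarrow> pre_theta_accumulates X \<F> x"
  by (auto simp: pre_theta_accumulates_def)

text \<open>
  A member inside the preclosure of \<open>V\<close> meets every other member, because any two members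
  of a filter base have nonempty intersection.
\<close>
lemma pre_theta_converges_imp_accumulates:
  assumes "filter_base_on S \<F>" "pre_theta_converges X \<F> x"
  shows "pre_theta_accumulates X \<F> x"
  unfolding pre_theta_accumulates_def
proof (intro allI impI ballI)
  fix V F assume V: "preopenin X V \<and> x \<in> V" and F: "F \<in> \<F>"
  obtain G where "G \<in> \<F>" "G \<subseteq> X preclosure_of V"
    using assms(2) V by (auto simp: pre_theta_converges_def)
  moreover then obtain H where "H \<in> \<F>" "H \<subseteq> F \<inter> G"
    using filter_base_on_meet[OF assms(1) F] by metis
  moreover then have "H \<noteq> {}"
    using filter_base_on_member[OF assms(1)] by simp
  ultimately show "X preclosure_of V \<inter> F \<noteq> {}"
    by blast
qed

lemma maximal_filter_base_on_converges_iff_accumulates: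
  assumes "maximal_filter_base_on S \<M>"
  shows "pre_theta_converges X \<M> x \<longleftrightarrow> pre_theta_accumulates X \<M> x"
proof
  show "pre_theta_converges X \<M> x \<Longrightarrow> pre_theta_accumulates X \<M> x"
    using assms pre_theta_converges_imp_accumulates by (auto simp: maximal_filter_base_on_def)
next
  show "pre_theta_accumulates X \<M> x \<Longrightarrow> pre_theta_converges X \<M> x"
    using maximal_filter_base_on_contains_subset[OF assms]
    by (simp add: pre_theta_accumulates_def pre_theta_converges_def)
qed

section \<open>Characterizations of p-closedness\<close>

text \<open>
  If no point is an accumulation point, every point has a preopen neighbourhood whose
  preclosure misses a member. Finitely many of these preclosures cover the space, so the
  finitely many missed members have no common point, although they contain a member.
\<close>
lemma p_closed_space_imp_accumulates:
  assumes "p_closed_space X" "filter_base_on (topspace X) \<F>"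
  shows "\<exists>x\<in>topspace X. pre_theta_accumulates X \<F> x"
proof (rule ccontr)
  assume none: "\<not> ?thesis"
  let ?V = "{V. preopenin X V \<and> (\<exists>F\<in>\<F>. X preclosure_of V \<inter> F = {})}"
  have "topspace X \<subseteq> \<Union>?V"
    using none unfolding pre_theta_accumulates_def by blast
  then have "\<Union>?V = topspace X"
    using preopenin_subset_topspace by blast
  then obtain \<W> where fin: "finite \<W>" and sub: "\<W> \<subseteq> ?V"
    and cover: "topspace X = (\<Union>V\<in>\<W>. X preclosure_of V)"
    using assms(1)[unfolded p_closed_space_def, rule_format, of ?V] by auto
  obtain f where f: "\<And>V. V \<in> \<W> \<Longrightarrow> f V \<in> \<F> \<and> X preclosure_of V \<inter> f V = {}"
    using sub by (simp add: subset_eq) metis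
  obtain H where H: "H \<in> \<F>" "H \<subseteq> \<Inter>(f ` \<W>)"
    using filter_base_on_finite_Inter[OF assms(2), of "f ` \<W>"] fin f by auto
  obtain x where x: "x \<in> H" "x \<in> topspace X"
    using filter_base_on_member[OF assms(2) H(1)] by blast
  then obtain V where "V \<in> \<W>" "x \<in> X preclosure_of V"
    using cover by blast
  moreover then have "x \<in> f V"
    using H(2) x(1) by blast
  ultimately show False
    using f[of V] by blast
qed

text \<open>
  For a cover without a good finite subfamily, the sets \<open>R \<W>\<close> left uncovered by the
  preclosures of finite subfamilies \<open>\<W>\<close> form a filter base: they are nonempty, and
  \<open>R (\<A> \<union> \<B>)\<close> is \<open>R \<A> \<inter> R \<B>\<close>. A member \<open>V\<close> of the cover that contains an accumulation
  point would have a preclosure meeting \<open>R {V}\<close>, which is absurd.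
\<close>
lemma accumulates_imp_p_closed_space:
  assumes acc: "\<And>\<F>. filter_base_on (topspace X) \<F> \<Longrightarrow>
                  \<exists>x\<in>topspace X. pre_theta_accumulates X \<F> x"
  shows "p_closed_space X"
  unfolding p_closed_space_def
proof (intro allI impI, elim conjE)
  fix \<V> assume open_V: "\<forall>V\<in>\<V>. preopenin X V" and cover: "\<Union>\<V> = topspace X"
  show "\<exists>\<W>. finite \<W> \<and> \<W> \<subseteq> \<V> \<and> topspace X = (\<Union>V\<in>\<W>. X preclosure_of V)"
  proof (rule ccontr)
    assume none: "\<not> ?thesis"
    define R where "R \<W> = topspace X - (\<Union>V\<in>\<W>. X preclosure_of V)" for \<W>
    let ?F = "R ` {\<W>. finite \<W> \<and> \<W> \<subseteq> \<V>}"
    have R_ne: "R \<W> \<noteq> {}" if "finite \<W>" "\<W> \<subseteq> \<V>" for \<W>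
    proof -
      have "(\<Union>V\<in>\<W>. X preclosure_of V) \<subseteq> topspace X"
        using that(2) open_V
        by (intro UN_least preclosure_of_subset_topspace preopenin_subset_topspace) blast
      then show ?thesis
        using none that unfolding R_def by blast
    qed
    have meet: "\<exists>H\<in>?F. H \<subseteq> F \<inter> G" if FG: "F \<in> ?F" "G \<in> ?F" for F G
    proof -
      obtain \<A> \<B> where "F = R \<A>" "finite \<A>" "\<A> \<subseteq> \<V>" "G = R \<B>" "finite \<B>" "\<B> \<subseteq> \<V>"
        using FG by blast
      then have "R (\<A> \<union> \<B>) \<in> ?F" "R (\<A> \<union> \<B>) \<subseteq> F \<inter> G"
        by (blast, auto simp: R_def)
      then show ?thesis
        by blast
    qed
    have "filter_base_on (topspace X) ?F"
    proof (intro filter_base_onI meet)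
      show "?F \<noteq> {}"
        by blast
      show "F \<noteq> {} \<and> F \<subseteq> topspace X" if "F \<in> ?F" for F
        using that R_ne by (auto simp: R_def)
    qed
    then obtain x where x: "x \<in> topspace X" "pre_theta_accumulates X ?F x"
      using acc by blast
    then obtain V where V: "V \<in> \<V>" "x \<in> V"
      using cover by blast
    have "R {V} \<in> ?F"
      using V by blast
    then have "X preclosure_of V \<inter> R {V} \<noteq> {}"
      using x(2) V open_V unfolding pre_theta_accumulates_def by blast
    then show False
      by (auto simp: R_def)
  qed
qed

text \<open>
  Complementation carries a preopen cover \<open>\<U>\<close> to a family of preclosed sets with empty
  intersection and back, and carries preclosures that cover to preinteriors with empty
  intersection.
\<close>
lemma p_closed_space_iff_preclosed_families:
  "p_closed_space X \<longleftrightarrow>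
     (\<forall>\<V>. (\<forall>V\<in>\<V>. preclosedin X V) \<and> topspace X \<inter> \<Inter>\<V> = {} \<longrightarrow>
        (\<exists>\<V>\<^sub>0. finite \<V>\<^sub>0 \<and> \<V>\<^sub>0 \<subseteq> \<V> \<and>
              topspace X \<inter> (\<Inter>V\<in>\<V>\<^sub>0. X preinterior_of V) = {}))"
  (is "_ \<longleftrightarrow> ?D")
proof
  assume pc: "p_closed_space X"
  show ?D
  proof (intro allI impI, elim conjE)
    fix \<V> assume closed_V: "\<forall>V\<in>\<V>. preclosedin X V" and empty: "topspace X \<inter> \<Inter>\<V> = {}"
    let ?c = "\<lambda>V. topspace X - V"
    have "\<forall>U\<in>?c ` \<V>. preopenin X U" "\<Union>(?c ` \<V>) = topspace X"
      using closed_V empty by (auto simp: preclosedin_def)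
    then obtain \<U> where "finite \<U>" "\<U> \<subseteq> ?c ` \<V>"
      and cover: "topspace X = (\<Union>U\<in>\<U>. X preclosure_of U)"
      using pc unfolding p_closed_space_def by meson
    then obtain \<W> where W: "\<W> \<subseteq> \<V>" "finite \<W>" "\<U> = ?c ` \<W>"
      using finite_subset_image by metis
    have sub: "\<And>V. V \<in> \<W> \<Longrightarrow> V \<subseteq> topspace X"
      using W(1) closed_V by (auto dest!: preclosedin_subset_topspace)
    have "(\<Union>V\<in>\<W>. X preclosure_of (?c V)) = topspace X"
      using cover unfolding W(3) image_image by (rule sym)
    also have "(\<Union>V\<in>\<W>. X preclosure_of (?c V)) = (\<Union>V\<in>\<W>. topspace X - X preinterior_of V)"
      using sub by (intro SUP_cong refl preclosure_of_complement)
    finally have "topspace X \<inter> (\<Inter>V\<in>\<W>. X preinterior_of V) = {}"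
      by blast
    then show "\<exists>\<V>\<^sub>0. finite \<V>\<^sub>0 \<and> \<V>\<^sub>0 \<subseteq> \<V> \<and> topspace X \<inter> (\<Inter>V\<in>\<V>\<^sub>0. X preinterior_of V) = {}"
      using W by blast
  qed
next
  assume D: ?D
  show "p_closed_space X"
    unfolding p_closed_space_def
  proof (intro allI impI, elim conjE)
    fix \<U> assume open_U: "\<forall>U\<in>\<U>. preopenin X U" and cover: "\<Union>\<U> = topspace X"
    let ?c = "\<lambda>U. topspace X - U"
    have sub: "\<And>U. U \<in> \<U> \<Longrightarrow> U \<subseteq> topspace X"
      using cover by blast
    have "\<forall>V\<in>?c ` \<U>. preclosedin X V"
      using open_U sub by (simp add: preclosedin_complement)
    moreover have "topspace X \<inter> \<Inter>(?c ` \<U>) = {}"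
      using cover by blast
    ultimately obtain \<V> where "finite \<V>" "\<V> \<subseteq> ?c ` \<U>"
      and empty: "topspace X \<inter> (\<Inter>V\<in>\<V>. X preinterior_of V) = {}"
      using D by meson
    then obtain \<W> where W: "\<W> \<subseteq> \<U>" "finite \<W>" "\<V> = ?c ` \<W>"
      using finite_subset_image by metis
    have W_sub: "\<And>U. U \<in> \<W> \<Longrightarrow> U \<subseteq> topspace X"
      using W(1) sub by blast
    have "(\<Inter>U\<in>\<W>. X preinterior_of (?c U)) = (\<Inter>U\<in>\<W>. topspace X - X preclosure_of U)"
      using W_sub by (intro INF_cong refl preinterior_of_complement)
    then have "topspace X \<inter> (\<Inter>U\<in>\<W>. topspace X - X preclosure_of U) = {}"
      using empty unfolding W(3) image_image by simp
    moreover have "\<And>U. U \<in> \<W> \<Longrightarrow> X preclosure_of U \<subseteq> topspace X"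
      using W_sub by (rule preclosure_of_subset_topspace)
    ultimately have "topspace X = (\<Union>U\<in>\<W>. X preclosure_of U)"
      by blast
    then show "\<exists>\<V>\<^sub>0. finite \<V>\<^sub>0 \<and> \<V>\<^sub>0 \<subseteq> \<U> \<and> topspace X = (\<Union>V\<in>\<V>\<^sub>0. X preclosure_of V)"
      using W by blast
  qed
qed

theorem theorem2p7:
  fixes X :: "'a topology"
  shows "(p_closed_space X \<longleftrightarrow>
           (\<forall>\<F>. maximal_filter_base_on (topspace X) \<F> \<longrightarrow>
              (\<exists>x\<in>topspace X. pre_theta_converges X \<F> x)))
       \<and> (p_closed_space X \<longleftrightarrow>
           (\<forall>\<F>. filter_base_on (topspace X) \<F> \<longrightarrow>
              (\<exists>x\<in>topspace X. pre_theta_accumulates X \<F> x)))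
       \<and> (p_closed_space X \<longleftrightarrow>
           (\<forall>\<V>. (\<forall>V\<in>\<V>. preclosedin X V) \<and> topspace X \<inter> \<Inter>\<V> = {} \<longrightarrow>
              (\<exists>\<V>\<^sub>0. finite \<V>\<^sub>0 \<and> \<V>\<^sub>0 \<subseteq> \<V> \<and>
                    topspace X \<inter> (\<Inter>V\<in>\<V>\<^sub>0. X preinterior_of V) = {})))"
proof (intro conjI)
  show acc_iff: "p_closed_space X \<longleftrightarrow>
      (\<forall>\<F>. filter_base_on (topspace X) \<F> \<longrightarrow> (\<exists>x\<in>topspace X. pre_theta_accumulates X \<F> x))"
    using p_closed_space_imp_accumulates accumulates_imp_p_closed_space by blast
  show "p_closed_space X \<longleftrightarrow>
      (\<forall>\<F>. maximal_filter_base_on (topspace X) \<F> \<longrightarrow> (\<exists>x\<in>topspace X. pre_theta_converges X \<F> x))"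
    unfolding acc_iff
    by (metis filter_base_on_extends_to_maximal maximal_filter_base_on_converges_iff_accumulates
        maximal_filter_base_on_def pre_theta_accumulates_antimono)
qed (rule p_closed_space_iff_preclosed_families)

end
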